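(* Let $m\ge1$ and let $0\ne w\in\bigotimes^3\mathbb{C}^m$ be a polystable tensor. Then the degree monoid $\mathcal{E}(w)$ generates the subgroup $m\,a(w)\,\mathbb{Z}$ of $\mathbb{Z}$, where $a(w)$ is the stabilizer period of $w$.
   Context: Work over $\mathbb{C}$. $\mathrm{GL}_m^3=\mathrm{GL}_m\times\mathrm{GL}_m\times\mathrm{GL}_m$ acts on $\bigotimes^3\mathbb{C}^m$ by $(g_1,g_2,g_3)w=(g_1\otimes g_2\otimes g_3)w$; $Gw$ denotes the $\mathrm{GL}_m^3$-orbit of $w$ and $\overline{Gw}$ its closure. (The subgroup $K=\{(\zeta_1\mathrm{I}_m,\zeta_2\mathrm{I}_m,\zeta_3\mathrm{I}_m)\mid\zeta_1\zeta_2\zeta_3=1\}$ acts trivially and $G=\mathrm{GL}_m^3/K$.) A tensor $w$ is polystable if its $\mathrm{SL}_m^3$-orbit is closed. $\mathrm{stab}(w)=\{(g_1,g_2,g_3)\in\mathrm{GL}_m^3\mid(g_1\otimes g_2\otimes g_3)w=w\}$ and $\chi(g_1,g_2,g_3)=\det(g_1)\det(g_2)\det(g_3)$. For nonzero polystable $w$ the group $\chi(\mathrm{stab}(w))\subseteq\mathbb{C}^\times$ is finite, and the stabilizer period $a(w)$ is its order. The degree monoid is $\mathcal{E}(w)=\{d\in\mathbb{N}\mid\mathcal{O}(\overline{Gw})^{\mathrm{SL}_m^3}_d\ne0\}$, where $\mathcal{O}(\overline{Gw})^{\mathrm{SL}_m^3}_d$ is the space of $\mathrm{SL}_m^3$-invariant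 regular functions on $\overline{Gw}$ homogeneous of degree $d$. *)

theory Defs
  imports "HOL-Analysis.Analysis" "HOL-Computational_Algebra.Group_Closure"
begin

text \<open>
  The format \<open>m\<close> is the cardinality of a finite index type \<open>'m\<close>. A tensor is its coordinate
  family \<open>w $ (i, j, k)\<close> with respect to the basis \<open>e\<^sub>i \<otimes> e\<^sub>j \<otimes> e\<^sub>k\<close>, so that scalars act by
  \<open>t *s w\<close>.
\<close>

type_synonym 'm tensor = "complex ^ ('m \<times> 'm \<times> 'm)"
type_synonym 'm matrix3 = "(complex ^ 'm ^ 'm) \<times> (complex ^ 'm ^ 'm) \<times> (complex ^ 'm ^ 'm)"

definition GL3 :: "('m::finite) matrix3 set" where
  "GL3 = {g. invertible g} \<times> {g. invertible g} \<times> {g. invertible g}"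

definition SL3 :: "('m::finite) matrix3 set" where
  "SL3 = {g. det g = 1} \<times> {g. det g = 1} \<times> {g. det g = 1}"

definition act :: "('m::finite) matrix3 \<Rightarrow> 'm tensor \<Rightarrow> 'm tensor" where
  "act = (\<lambda>(g1, g2, g3) w. vec_lambda (\<lambda>(i, j, k).
     \<Sum>a\<in>UNIV. \<Sum>b\<in>UNIV. \<Sum>c\<in>UNIV. g1 $ i $ a * g2 $ j $ b * g3 $ k $ c * w $ (a, b, c)))"

inductive polynomial_fun :: "(complex ^ 'n \<Rightarrow> complex) \<Rightarrow> bool" where
  const: "polynomial_fun (\<lambda>x. c)"
| coord: "polynomial_fun (\<lambda>x. x $ i)"
| add: "polynomial_fun p \<Longrightarrow> polynomial_fun q \<Longrightarrow> polynomial_fun (\<lambda>x. p x + q x)"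
| mult: "polynomial_fun p \<Longrightarrow> polynomial_fun q \<Longrightarrow> polynomial_fun (\<lambda>x. p x * q x)"

text \<open>
  Closedness and closure are taken in the Zariski topology. For orbits of algebraic group actions
  over the complex numbers they agree with their Euclidean counterparts.
\<close>

definition zariski_closed :: "(complex ^ 'n) set \<Rightarrow> bool" where
  "zariski_closed Z \<longleftrightarrow> (\<exists>P. (\<forall>p\<in>P. polynomial_fun p) \<and> Z = {x. \<forall>p\<in>P. p x = 0})"

text \<open>Regular functions on a closed set \<open>Z\<close> are represented extensionally, i.e.\ as
  \<^const>\<open>undefined\<close> outside \<open>Z\<close>.\<close>

definition regular_functions :: "(complex ^ 'n) set \<Rightarrow> (complex ^ 'n \<Rightarrow> complex) set" where
  "regular_functions Z = {restrict p Z | p. polynomial_fun p}"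

definition orbit_closure :: "('m::finite) tensor \<Rightarrow> 'm tensor set" where
  "orbit_closure w = zariski_closed hull ((\<lambda>g. act g w) ` GL3)"

definition polystable :: "('m::finite) tensor \<Rightarrow> bool" where
  "polystable w \<longleftrightarrow> zariski_closed ((\<lambda>g. act g w) ` SL3)"

definition stab :: "('m::finite) tensor \<Rightarrow> 'm matrix3 set" where
  "stab w = {g \<in> GL3. act g w = w}"

definition chi :: "('m::finite) matrix3 \<Rightarrow> complex" where
  "chi = (\<lambda>(g1, g2, g3). det g1 * det g2 * det g3)"

text \<open>The group \<open>chi ` stab w\<close> is finite for nonzero polystable \<open>w\<close>; its order is then its
  cardinality.\<close>

definition stabilizer_period :: "('m::finite) tensor \<Rightarrow> nat" where
  "stabilizer_period w = card (chi ` stab w)"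

text \<open>
  The orbit closure is stable under the action of \<^const>\<open>GL3\<close>, and it is a cone containing \<open>0\<close>
  (scalar matrices scale the tensor), so \<open>f\<close> is only ever evaluated inside its domain here.
\<close>

definition invariants :: "('m::finite) tensor \<Rightarrow> nat \<Rightarrow> ('m tensor \<Rightarrow> complex) set" where
  "invariants w d = {f \<in> regular_functions (orbit_closure w).
     (\<forall>g\<in>SL3. \<forall>x\<in>orbit_closure w. f (act g x) = f x) \<and>
     (\<forall>t. \<forall>x\<in>orbit_closure w. f (t *s x) = t ^ d * f x)}"

definition degree_monoid :: "('m::finite) tensor \<Rightarrow> nat set" where
  "degree_monoid w = {d. \<exists>f\<in>invariants w d. \<exists>x\<in>orbit_closure w. f x \<noteq> 0}"

end

theory Submission
  imports Defs "HOL-Computational_Algebra.Fundamental_Theorem_Algebra"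
begin

text \<open>
  Both sides of the theorem are read off from the group \<open>M\<close> of all nonzero scalars \<open>z\<close> such that
  \<open>z *s w\<close> lies in the special linear orbit of \<open>w\<close> (\<open>orbit_scalars\<close>).

  On the one hand, \<open>z\<close> belongs to \<open>M\<close> if and only if the inverse of its \<open>m\<close>-th power is the value
  of \<open>chi\<close> at a stabilizer element. Hence \<open>M\<close> has \<open>m\<close> times as many elements as \<open>chi ` stab w\<close>.

  On the other hand, \<open>M\<close> consists of the \<open>z \<noteq> 0\<close> with \<open>z ^ d = 1\<close> for all \<open>d\<close> in the degree
  monoid. The equations hold on \<open>M\<close> because an invariant of degree \<open>d\<close> that is not zero does not
  vanish at \<open>w\<close> (\<open>degree_kills_orbit_scalars\<close>). Conversely, if \<open>z\<close> is not in \<open>M\<close>, then \<open>w\<close> and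
  \<open>z *s w\<close> have disjoint closed orbits, and these are separated by a homogeneous invariant, whose
  degree \<open>d\<close> then satisfies \<open>z ^ d \<noteq> 1\<close> (\<open>orbit_scalar_if_degrees_kill\<close>). So \<open>M\<close> is the group
  of \<open>n\<close>-th roots of unity, where \<open>n\<close> generates the same subgroup of the integers as the degree
  monoid, and counting \<open>M\<close> in the two ways gives the theorem. This also covers the degenerate case
  in which \<open>M\<close> is infinite, where \<open>n\<close> and the period are both \<open>0\<close>.

  Separating closed orbits by invariants takes two ingredients. The weak Nullstellensatz yields a
  polynomial that is \<open>0\<close> on one orbit and \<open>1\<close> on the other; its proof uses that the field of
  complex numbers is uncountable. To make this polynomial invariant without integrating over a
  group, it is projected onto the orthogonal complement of the polynomials that vanish on both
  orbits, with respect to an inner product on coefficients for which the adjoint of a substitution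
  is the substitution by the conjugate transpose (\<open>invariant_polynomial_extension\<close>).
\<close>

section \<open>Polynomial functions as linear combinations of monomials\<close>

text \<open>
  Monomials are indexed by words, i.e. by the basis of the tensor algebra, although words that
  differ only in the order of their letters give the same function. The redundant coefficients make
  a linear substitution act on them by tensor powers of a matrix, whose adjoint is the tensor power
  of the conjugate transpose.
\<close>

definition monomial :: "complex ^ 'n \<Rightarrow> 'n list \<Rightarrow> complex" where
  "monomial x xs = prod_list (map (($) x) xs)"

lemma monomial_simps [simp]:
  "monomial x [] = 1"
  "monomial x (i # xs) = x $ i * monomial x xs"
  "monomial x (xs @ ys) = monomial x xs * monomial x ys"
  by (simp_all add: monomial_def)

lemma finite_words_le [simp, intro]: "finite {xs :: 'n::finite list. length xs \<le> D}"
  using finite_lists_length_le[of "UNIV :: 'n set" D] by simp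

lemma finite_words [simp, intro]: "finite {xs :: 'n::finite list. length xs = D}"
  using finite_lists_length_eq[of "UNIV :: 'n set" D] by simp

definition polys_le :: "nat \<Rightarrow> (complex ^ 'n::finite \<Rightarrow> complex) set" where
  "polys_le D = {p. \<exists>T. p = (\<lambda>x. \<Sum>xs | length xs \<le> D. T xs * monomial x xs)}"

lemma polys_le_mono: "polys_le D \<subseteq> polys_le E" if "D \<le> E"
proof
  fix p :: "complex ^ 'n \<Rightarrow> complex"
  assume "p \<in> polys_le D"
  then obtain T where T: "p = (\<lambda>x. \<Sum>xs | length xs \<le> D. T xs * monomial x xs)"
    by (auto simp: polys_le_def)
  have "p x = (\<Sum>xs | length xs \<le> E. (if length xs \<le> D then T xs else 0) * monomial x xs)" for x
    unfolding T using that by (intro sum.mono_neutral_cong_left) auto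
  then show "p \<in> polys_le E"
    by (auto simp: polys_le_def intro!: exI[of _ "\<lambda>xs. if length xs \<le> D then T xs else 0"])
qed

lemma polys_le_zero: "(\<lambda>x. 0) \<in> polys_le D"
  by (auto simp: polys_le_def intro!: exI[of _ "\<lambda>_. 0"])

lemma polys_le_add: "(\<lambda>x. p x + q x) \<in> polys_le D" if pq: "p \<in> polys_le D" "q \<in> polys_le D"
proof -
  obtain T U where "p = (\<lambda>x. \<Sum>xs | length xs \<le> D. T xs * monomial x xs)"
    "q = (\<lambda>x. \<Sum>xs | length xs \<le> D. U xs * monomial x xs)"
    using pq unfolding polys_le_def by blast
  then show ?thesis
    by (auto simp: polys_le_def sum.distrib[symmetric] algebra_simps
        intro!: exI[of _ "\<lambda>xs. T xs + U xs"])
qed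

lemma polys_le_sum: "(\<lambda>x. \<Sum>a\<in>A. f a x) \<in> polys_le D" if "\<And>a. a \<in> A \<Longrightarrow> f a \<in> polys_le D"
  using that by (induction A rule: infinite_finite_induct) (auto intro: polys_le_add polys_le_zero)

lemma polys_le_monomial: "(\<lambda>x. c * monomial x ys) \<in> polys_le D" if "length ys \<le> D"
proof -
  have "(\<Sum>xs | length xs \<le> D. (if xs = ys then c else 0) * monomial x xs) = c * monomial x ys"
    for x :: "complex ^ 'a"
    using that by (subst sum.remove[of _ ys]) (auto intro: sum.neutral)
  then show ?thesis
    by (auto simp: polys_le_def intro!: exI[of _ "\<lambda>xs. if xs = ys then c else 0"])
qed

lemma polys_le_mult: "(\<lambda>x. p x * q x) \<in> polys_le (D + E)"
  if pq: "p \<in> polys_le D" "q \<in> polys_le E"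
proof -
  obtain T U where *: "p = (\<lambda>x. \<Sum>xs | length xs \<le> D. T xs * monomial x xs)"
    "q = (\<lambda>x. \<Sum>xs | length xs \<le> E. U xs * monomial x xs)"
    using pq unfolding polys_le_def by blast
  have "p x * q x = (\<Sum>xs | length xs \<le> D. \<Sum>ys | length ys \<le> E.
      (T xs * U ys) * monomial x (xs @ ys))" for x
    by (simp add: * sum_product mult_ac)
  moreover have "(\<lambda>x. \<Sum>xs | length xs \<le> D. \<Sum>ys | length ys \<le> E.
      (T xs * U ys) * monomial x (xs @ ys)) \<in> polys_le (D + E)"
    by (intro polys_le_sum polys_le_monomial) auto
  ultimately show ?thesis
    by presburger
qed

lemma polynomial_fun_degree_bound: "\<exists>D. p \<in> polys_le D" if "polynomial_fun p"
  using that
proof induction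
  case (const c)
  show ?case using polys_le_monomial[of "[]" 0 c] by auto
next
  case (coord i)
  show ?case using polys_le_monomial[of "[i]" 1 1] by auto
next
  case (add p q)
  then obtain D E where "p \<in> polys_le D" "q \<in> polys_le E" by auto
  then have "p \<in> polys_le (max D E)" "q \<in> polys_le (max D E)"
    using polys_le_mono[of D "max D E"] polys_le_mono[of E "max D E"] by auto
  then show ?case by (blast intro: polys_le_add)
next
  case (mult p q)
  then show ?case by (blast intro: polys_le_mult)
qed

lemma polynomial_fun_monomial: "polynomial_fun (\<lambda>x. monomial x xs)"
  by (induction xs) (auto intro: polynomial_fun.intros)

lemma polynomial_fun_sum: "polynomial_fun (\<lambda>x. \<Sum>a\<in>A. f a x)"
  if "\<And>a. a \<in> A \<Longrightarrow> polynomial_fun (f a)"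
  using that by (induction A rule: infinite_finite_induct) (auto intro: polynomial_fun.intros)

lemma polynomial_fun_diff: "polynomial_fun (\<lambda>x. p x - q x)"
  if "polynomial_fun p" "polynomial_fun q"
  using polynomial_fun.add[OF that(1) polynomial_fun.mult[OF polynomial_fun.const[of "-1"] that(2)]]
  by simp

lemma polynomial_fun_matrix:
  fixes A :: "complex ^ 'n ^ 'k"
  assumes "polynomial_fun p"
  shows "polynomial_fun (\<lambda>x. p (A *v x))"
  using assms
  by induction (auto simp: matrix_vector_mult_def intro!: polynomial_fun_sum polynomial_fun.intros)

lemma polynomial_fun_scale: "polynomial_fun (\<lambda>x. p (t *s x))" if "polynomial_fun p"
  using that by induction (auto intro!: polynomial_fun.intros)

lemma continuous_on_polynomial_fun: "continuous_on UNIV p" if "polynomial_fun p"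
  using that by induction (auto intro!: continuous_intros)

lemma sum_words_by_length: "(\<Sum>xs | length xs \<le> D. f xs) = (\<Sum>d\<le>D. \<Sum>xs | length xs = d. f xs)"
  for f :: "'n::finite list \<Rightarrow> complex"
proof -
  have "{xs :: 'n list. length xs \<le> D} = (\<Union>d\<le>D. {xs. length xs = d})" by auto
  then show ?thesis
    by (simp add: sum.UNION_disjoint disjoint_iff)
qed

section \<open>Two facts of finite linear algebra\<close>

text \<open>
  Gaussian elimination: an equation that involves some unknown is used up to eliminate it, and
  one that involves none is dropped, so there are always more unknowns than equations.
\<close>

lemma homogeneous_system_nontrivial_solution:
  fixes T :: "'c \<Rightarrow> 'l \<Rightarrow> complex"
  assumes "finite L" "finite C" "card L < card C"
  shows "\<exists>a. (\<exists>c\<in>C. a c \<noteq> 0) \<and> (\<forall>l\<in>L. (\<Sum>c\<in>C. a c * T c l) = 0)"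
  using assms
proof (induction L arbitrary: C T rule: finite_induct)
  case empty
  then have "C \<noteq> {}" by auto
  then show ?case by (intro exI[of _ "\<lambda>_. 1"]) auto
next
  case (insert l L)
  show ?case
  proof (cases "\<forall>c\<in>C. T c l = 0")
    case True
    have "card L < card C" using insert by simp
    with insert.IH[of C T] insert.prems True show ?thesis by auto
  next
    case False
    then obtain c0 where c0: "c0 \<in> C" "T c0 l \<noteq> 0" by auto
    define C' where "C' = C - {c0}"
    define T' where "T' c y = T c y - T c l / T c0 l * T c0 y" for c y
    have "card L < card C'" "finite C'" using insert c0 by (auto simp: C'_def)
    from insert.IH[OF this(2,1), of T'] obtain a where
      a: "\<exists>c\<in>C'. a c \<noteq> 0" "\<forall>y\<in>L. (\<Sum>c\<in>C'. a c * T' c y) = 0" by auto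
    define k where "k = - (\<Sum>c\<in>C'. a c * T c l) / T c0 l"
    define b where "b = a(c0 := k)"
    have b: "(\<Sum>c\<in>C. b c * T c y) = k * T c0 y + (\<Sum>c\<in>C'. a c * T c y)" for y
      using c0 insert.prems by (subst sum.remove[of _ c0]) (auto simp: b_def C'_def)
    have "(\<Sum>c\<in>C'. a c * T' c y) = (\<Sum>c\<in>C'. a c * T c y) + k * T c0 y" for y
      by (simp add: T'_def k_def algebra_simps sum_subtractf sum_distrib_left sum_distrib_right
          sum_divide_distrib)
    with a b have "\<forall>y\<in>L. (\<Sum>c\<in>C. b c * T c y) = 0" by (simp add: add.commute)
    moreover have "(\<Sum>c\<in>C. b c * T c l) = 0" using c0 by (simp add: b k_def)
    moreover have "\<exists>c\<in>C. b c \<noteq> 0" using a(1) by (auto simp: b_def C'_def)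
    ultimately show ?thesis by (intro exI[of _ b]) auto
  qed
qed

text \<open>
  Induction over the coordinates. If some vector of \<open>W\<close> has a nonzero entry at the new
  coordinate \<open>k\<close>, then \<open>W\<close> is the orthogonal sum of the hyperplane \<open>W0\<close> of vectors vanishing at
  \<open>k\<close> and of the line through the component of that vector orthogonal to \<open>W0\<close>; projecting onto
  \<open>W0\<close> and onto the line gives the projection onto \<open>W\<close>.
\<close>

lemma orthogonal_projection:
  fixes W :: "('l \<Rightarrow> complex) set"
  assumes "finite L"
    and "(\<lambda>_. 0) \<in> W"
    and "\<And>u v. u \<in> W \<Longrightarrow> v \<in> W \<Longrightarrow> (\<lambda>l. u l + v l) \<in> W"
    and "\<And>c u. u \<in> W \<Longrightarrow> (\<lambda>l. c * u l) \<in> W"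
  shows "\<exists>w\<in>W. \<forall>u\<in>W. (\<Sum>l\<in>L. (T l - w l) * cnj (u l)) = 0"
  using assms
proof (induction L arbitrary: W T rule: finite_induct)
  case empty
  then show ?case by auto
next
  case (insert k L)
  note zero = insert.prems(1) and add = insert.prems(2) and scale = insert.prems(3)
  show ?case
  proof (cases "\<forall>u\<in>W. u k = 0")
    case True
    obtain w where "w \<in> W" "\<forall>u\<in>W. (\<Sum>l\<in>L. (T l - w l) * cnj (u l)) = 0"
      using insert.IH[OF insert.prems] by blast
    with True insert.hyps show ?thesis by (intro bexI[of _ w]) auto
  next
    case False
    then obtain v0 where "v0 \<in> W" "v0 k \<noteq> 0" by auto
    then obtain v where v: "v \<in> W" "v k = 1"
      using scale[of v0 "inverse (v0 k)"] by (metis (mono_tags) left_inverse)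
    define W0 where "W0 = {u \<in> W. u k = 0}"
    have IH: "\<exists>w\<in>W0. \<forall>u\<in>W0. (\<Sum>l\<in>insert k L. (T l - w l) * cnj (u l)) = 0" for T
      using insert.IH[of W0 T] insert.hyps zero add scale by (simp add: W0_def)
    obtain w0 where w0: "w0 \<in> W0" "\<And>u. u \<in> W0 \<Longrightarrow> (\<Sum>l\<in>insert k L. (v l - w0 l) * cnj (u l)) = 0"
      using IH by meson
    define v' where "v' l = v l - w0 l" for l
    have v': "v' \<in> W" "v' k = 1"
      using w0(1) v add[OF v(1) scale[of w0 "-1"]] by (auto simp: W0_def v'_def[abs_def])
    have v'_perp: "(\<Sum>l\<in>insert k L. v' l * cnj (u l)) = 0" if "u \<in> W0" for u
      using w0(2)[OF that] by (simp add: v'_def)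
    define s where "s = (\<Sum>l\<in>insert k L. v' l * cnj (v' l))"
    have "s = of_real (\<Sum>l\<in>insert k L. (cmod (v' l))\<^sup>2)"
      by (simp only: s_def complex_norm_square of_real_sum)
    moreover have "(\<Sum>l\<in>insert k L. (cmod (v' l))\<^sup>2) > 0"
      using insert.hyps(1) v'(2) by (intro sum_pos2[of _ k]) auto
    ultimately have "s \<noteq> 0" by (metis of_real_eq_0_iff less_irrefl)
    obtain w1 where w1: "w1 \<in> W0" "\<And>u. u \<in> W0 \<Longrightarrow> (\<Sum>l\<in>insert k L. (T l - w1 l) * cnj (u l)) = 0"
      using IH by meson
    define c where "c = (\<Sum>l\<in>insert k L. (T l - w1 l) * cnj (v' l)) / s"
    define w where "w l = w1 l + c * v' l" for l
    have "w \<in> W" using w1(1) v' add scale by (auto simp: w_def[abs_def] W0_def)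
    moreover have "(\<Sum>l\<in>insert k L. (T l - w l) * cnj (u l)) = 0" if "u \<in> W" for u
    proof -
      define u0 where "u0 l = u l - u k * v' l" for l
      have u0: "u0 \<in> W0"
        using add[OF that scale[OF v'(1), of "- u k"]] v'(2) by (simp add: W0_def u0_def[abs_def])
      have "(\<Sum>l\<in>insert k L. (T l - w l) * cnj (v' l)) = 
        (\<Sum>l\<in>insert k L. (T l - w1 l) * cnj (v' l) - c * (v' l * cnj (v' l)))"
        by (intro sum.cong) (auto simp: w_def algebra_simps)
      also have "\<dots> = 0" using \<open>s \<noteq> 0\<close>
        by (simp only: sum_subtractf sum_distrib_left[symmetric] s_def[symmetric]) (simp add: c_def)
      finally have 1: "(\<Sum>l\<in>insert k L. (T l - w l) * cnj (v' l)) = 0" .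
      have "(\<Sum>l\<in>insert k L. (T l - w l) * cnj (u0 l)) = 
        (\<Sum>l\<in>insert k L. (T l - w1 l) * cnj (u0 l) - c * (v' l * cnj (u0 l)))"
        by (intro sum.cong) (auto simp: w_def algebra_simps)
      also have "\<dots> = 0"
        by (simp only: sum_subtractf sum_distrib_left[symmetric] v'_perp[OF u0] w1(2)[OF u0]) simp
      finally have 2: "(\<Sum>l\<in>insert k L. (T l - w l) * cnj (u0 l)) = 0" .
      have "(\<Sum>l\<in>insert k L. (T l - w l) * cnj (u l)) = 
        (\<Sum>l\<in>insert k L. (T l - w l) * cnj (u0 l) + cnj (u k) * ((T l - w l) * cnj (v' l)))"
        by (intro sum.cong) (auto simp: u0_def algebra_simps)
      also have "\<dots> = 0"
        by (simp only: sum.distrib sum_distrib_left[symmetric] 1 2) simp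
      finally show ?thesis .
    qed
    ultimately show ?thesis by blast
  qed
qed

section \<open>The weak Nullstellensatz over the complex numbers\<close>

definition poly_ideal :: "(complex ^ 'n::finite \<Rightarrow> complex) set \<Rightarrow> bool" where
  "poly_ideal I \<longleftrightarrow> I \<subseteq> Collect polynomial_fun \<and> (\<lambda>_. 0) \<in> I \<and>
     (\<forall>p\<in>I. \<forall>q\<in>I. (\<lambda>x. p x + q x) \<in> I) \<and>
     (\<forall>r p. polynomial_fun r \<longrightarrow> p \<in> I \<longrightarrow> (\<lambda>x. r x * p x) \<in> I)"

lemma poly_idealD:
  assumes "poly_ideal I"
  shows "p \<in> I \<Longrightarrow> polynomial_fun p" "(\<lambda>_. 0) \<in> I"
    "p \<in> I \<Longrightarrow> q \<in> I \<Longrightarrow> (\<lambda>x. p x + q x) \<in> I"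
    "polynomial_fun r \<Longrightarrow> p \<in> I \<Longrightarrow> (\<lambda>x. r x * p x) \<in> I"
  using assms by (auto simp: poly_ideal_def)

lemma poly_ideal_sum:
  "poly_ideal I \<Longrightarrow> (\<And>a. a \<in> A \<Longrightarrow> f a \<in> I) \<Longrightarrow> (\<lambda>x. \<Sum>a\<in>A. f a x) \<in> I"
  by (induction A rule: infinite_finite_induct) (auto intro: poly_idealD)

lemma poly_ideal_diff:
  "poly_ideal I \<Longrightarrow> p \<in> I \<Longrightarrow> q \<in> I \<Longrightarrow> (\<lambda>x. p x - q x) \<in> I"
  using poly_idealD(3)[of I p "\<lambda>x. - 1 * q x"]
    poly_idealD(4)[OF _ polynomial_fun.const[of "-1"], of I q] by simp

lemma poly_ideal_adjoin:
  assumes I: "poly_ideal I" and q: "polynomial_fun q"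
  shows "poly_ideal {f. \<exists>p\<in>I. \<exists>r. polynomial_fun r \<and> f = (\<lambda>x. p x + r x * q x)}"
    (is "poly_ideal ?J")
  unfolding poly_ideal_def
proof (intro conjI ballI allI impI)
  show "?J \<subseteq> Collect polynomial_fun"
    using poly_idealD(1)[OF I] q by (auto intro!: polynomial_fun.add polynomial_fun.mult)
  show "(\<lambda>_. 0) \<in> ?J"
    using poly_idealD(2)[OF I] polynomial_fun.const[of 0]
    by (auto intro!: bexI[of _ "\<lambda>_. 0"] exI[of _ "\<lambda>_. 0"])
next
  fix f g assume "f \<in> ?J" "g \<in> ?J"
  then obtain p r p' r' where *: "p \<in> I" "p' \<in> I" "polynomial_fun r" "polynomial_fun r'"
    "f = (\<lambda>x. p x + r x * q x)" "g = (\<lambda>x. p' x + r' x * q x)" by auto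
  then show "(\<lambda>x. f x + g x) \<in> ?J"
    using poly_idealD(3)[OF I *(1,2)] polynomial_fun.add[OF *(3,4)]
    by (auto simp: algebra_simps intro!: bexI[of _ "\<lambda>x. p x + p' x"] exI[of _ "\<lambda>x. r x + r' x"])
next
  fix s f :: "complex ^ 'a \<Rightarrow> complex" assume s: "polynomial_fun s" and "f \<in> ?J"
  then obtain p r where *: "p \<in> I" "polynomial_fun r"
    "f = (\<lambda>x. p x + r x * q x)" by auto
  then show "(\<lambda>x. s x * f x) \<in> ?J"
    using poly_idealD(4)[OF I s *(1)] polynomial_fun.mult[OF s *(2)]
    by (auto simp: algebra_simps intro!: bexI[of _ "\<lambda>x. s x * p x"] exI[of _ "\<lambda>x. s x * r x"])
qed

text \<open>
  Zorn's lemma, with maximality rephrased as the fact used below: modulo \<open>M\<close>, everything outside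
  \<open>M\<close> is invertible.
\<close>

lemma exists_maximal_poly_ideal:
  assumes "poly_ideal I" "(\<lambda>_. 1) \<notin> I"
  obtains M where "poly_ideal M" "I \<subseteq> M" "(\<lambda>_. 1) \<notin> M"
    "\<And>q. polynomial_fun q \<Longrightarrow> q \<notin> M \<Longrightarrow> \<exists>r. polynomial_fun r \<and> (\<lambda>x. r x * q x - 1) \<in> M"
proof -
  define \<A> where "\<A> = {J. poly_ideal J \<and> I \<subseteq> J \<and> (\<lambda>_. 1) \<notin> J}"
  have "\<exists>M\<in>\<A>. \<forall>X\<in>\<A>. M \<subseteq> X \<longrightarrow> X = M"
  proof (rule subset_Zorn_nonempty)
    show "\<A> \<noteq> {}" using assms by (auto simp: \<A>_def)
    fix \<C> assume "\<C> \<noteq> {}" and chain: "subset.chain \<A> \<C>"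
    then have sub: "\<C> \<subseteq> \<A>" and tot: "\<And>X Y. X \<in> \<C> \<Longrightarrow> Y \<in> \<C> \<Longrightarrow> X \<subseteq> Y \<or> Y \<subseteq> X"
      by (auto simp: subset_chain_def)
    then have id: "\<And>J. J \<in> \<C> \<Longrightarrow> poly_ideal J" by (auto simp: \<A>_def)
    have "poly_ideal (\<Union>\<C>)"
      unfolding poly_ideal_def
    proof (intro conjI ballI allI impI)
      show "\<Union>\<C> \<subseteq> Collect polynomial_fun" using id poly_idealD(1) by auto
      obtain J where "J \<in> \<C>" using \<open>\<C> \<noteq> {}\<close> by blast
      then show "(\<lambda>_. 0) \<in> \<Union>\<C>" using poly_idealD(2)[OF id] by blast
    next
      fix p q assume "p \<in> \<Union>\<C>" "q \<in> \<Union>\<C>"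
      then obtain X Y where "X \<in> \<C>" "p \<in> X" "Y \<in> \<C>" "q \<in> Y" by blast
      then obtain J where J: "J \<in> \<C>" "p \<in> J" "q \<in> J" using tot[of X Y] by blast
      show "(\<lambda>x. p x + q x) \<in> \<Union>\<C>"
        using poly_idealD(3)[OF id[OF J(1)] J(2,3)] J(1) by (rule UnionI[rotated])
    next
      fix r p :: "complex ^ 'a \<Rightarrow> complex"
      assume r: "polynomial_fun r" and "p \<in> \<Union>\<C>"
      then obtain J where J: "J \<in> \<C>" "p \<in> J" by blast
      show "(\<lambda>x. r x * p x) \<in> \<Union>\<C>"
        using poly_idealD(4)[OF id[OF J(1)] r J(2)] J(1) by (rule UnionI[rotated])
    qed
    then show "\<Union>\<C> \<in> \<A>"
      using sub \<open>\<C> \<noteq> {}\<close> by (auto simp: \<A>_def)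
  qed
  then obtain M where M: "poly_ideal M" "I \<subseteq> M" "(\<lambda>_. 1) \<notin> M"
    and max: "\<And>X. poly_ideal X \<Longrightarrow> (\<lambda>_. 1) \<notin> X \<Longrightarrow> M \<subseteq> X \<Longrightarrow> X = M"
    by (auto simp: \<A>_def)
  show thesis
  proof (rule that[OF M])
    fix q :: "complex ^ 'a \<Rightarrow> complex"
    assume q: "polynomial_fun q" "q \<notin> M"
    define J where "J = {f. \<exists>p\<in>M. \<exists>r. polynomial_fun r \<and> f = (\<lambda>x. p x + r x * q x)}"
    have "poly_ideal J" unfolding J_def by (rule poly_ideal_adjoin[OF M(1) q(1)])
    moreover have "M \<subseteq> J"
      using polynomial_fun.const[of 0] by (force simp: J_def)
    moreover have "q \<in> J"
      using polynomial_fun.const[of 1] poly_idealD(2)[OF M(1)] by (force simp: J_def)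
    ultimately have "(\<lambda>_. 1) \<in> J" using max[of J] q(2) by auto
    then obtain p r where p: "p \<in> M" and r: "polynomial_fun r" and eq: "(\<lambda>_. 1) = (\<lambda>x. p x + r x * q x)"
      by (auto simp: J_def)
    have "r x * q x - 1 = 0 - p x" for x using fun_cong[OF eq, of x] by (simp add: algebra_simps)
    then have "(\<lambda>x. r x * q x - 1) \<in> M"
      using poly_ideal_diff[OF M(1) poly_idealD(2)[OF M(1)] p] by simp
    with r show "\<exists>r. polynomial_fun r \<and> (\<lambda>x. r x * q x - 1) \<in> M" by blast
  qed
qed

lemma polynomial_fun_poly: "polynomial_fun (\<lambda>x. poly P (x $ i))"
  by (induction P) (auto intro!: polynomial_fun.intros)

lemma infinite_fibre_of_nat_valued:
  fixes D :: "complex \<Rightarrow> nat"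
  shows "\<exists>n. infinite {c. D c = n}"
proof (rule ccontr)
  assume "\<not> ?thesis"
  then have "countable (\<Union>n. {c. D c = n})" by (intro countable_UN) (auto intro: countable_finite)
  moreover have "(\<Union>n. {c. D c = n}) = UNIV" by auto
  ultimately have "countable (range complex_of_real)" by (metis countable_subset subset_UNIV)
  then have "countable (UNIV :: real set)" using countable_image_inj_on[of complex_of_real UNIV]
    by (auto simp: inj_on_def)
  then show False using uncountable_UNIV_real by simp
qed

text \<open>
  Let \<open>M\<close> be a maximal ideal containing \<open>I\<close>. The quotient by \<open>M\<close> is a field of countable
  dimension over the uncountable field of complex numbers. If no \<open>x $ i - c\<close> lay in \<open>M\<close>, the
  uncountably many inverses \<open>q c\<close> of \<open>x $ i - c\<close> in the quotient would be linearly dependent.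
  Clearing denominators in a linear relation yields a nonzero univariate polynomial \<open>P\<close> with
  \<open>P(x $ i) \<in> M\<close>; but \<open>P\<close> is a product of linear factors, which are invertible modulo \<open>M\<close>.
  Hence for each \<open>i\<close> some \<open>x $ i - c i\<close> lies in \<open>M\<close>, and the point with coordinates \<open>c i\<close> is a
  zero of \<open>M\<close>.
\<close>

theorem weak_nullstellensatz:
  fixes I :: "(complex ^ 'n::finite \<Rightarrow> complex) set"
  assumes "poly_ideal I" "(\<lambda>_. 1) \<notin> I"
  shows "\<exists>z. \<forall>p\<in>I. p z = 0"
proof -
  obtain M where M: "poly_ideal M" "I \<subseteq> M" "(\<lambda>_. 1) \<notin> M"
    and inv: "\<And>q. polynomial_fun q \<Longrightarrow> q \<notin> M \<Longrightarrow> \<exists>r. polynomial_fun r \<and> (\<lambda>x. r x * q x - 1) \<in> M"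
    using exists_maximal_poly_ideal[OF assms] by metis
  have no_unit: False if "polynomial_fun r" "(\<lambda>x. r x * q x - 1) \<in> M" "q \<in> M" for r q
    using poly_ideal_diff[OF M(1) poly_idealD(4)[OF M(1) that(1,3)] that(2)] M(3) by simp
  have "\<exists>c. (\<lambda>x. x $ i - c) \<in> M" for i
  proof (rule ccontr)
    assume contra: "\<nexists>c. (\<lambda>x. x $ i - c) \<in> M"
    have lin: "polynomial_fun (\<lambda>x::complex ^ 'n. x $ i - c)" for c
      by (intro polynomial_fun_diff polynomial_fun.intros)
    have "\<exists>r. polynomial_fun r \<and> (\<lambda>x. r x * (x $ i - c) - 1) \<in> M" for c
      using inv[OF lin] contra by blast
    then obtain q where q: "\<And>c. polynomial_fun (q c)" "\<And>c. (\<lambda>x. q c x * (x $ i - c) - 1) \<in> M"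
      by metis
    have unit: "\<exists>r. polynomial_fun r \<and> (\<lambda>x. r x * poly P (x $ i) - 1) \<in> M" if "P \<noteq> 0" for P
      using that
    proof (induction "degree P" arbitrary: P)
      case 0
      then obtain a where "P = [:a:]" "a \<noteq> 0" by (metis degree_eq_zeroE pCons_0_0)
      then show ?case
        using poly_idealD(2)[OF M(1)] polynomial_fun.const[of "1/a"]
        by (intro exI[of _ "\<lambda>_. 1/a"]) auto
    next
      case (Suc n)
      then have "\<not> constant (poly P)" by (simp add: constant_degree)
      then obtain z where "poly P z = 0" using fundamental_theorem_of_algebra by blast
      then obtain Q where Q: "P = [:-z, 1:] * Q" using poly_eq_0_iff_dvd by blast
      then have "Q \<noteq> 0" using Suc by auto
      then have "degree Q = n" using Suc(2) unfolding Q by (subst (asm) degree_mult_eq) auto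
      then obtain r where r: "polynomial_fun r" "(\<lambda>x. r x * poly Q (x $ i) - 1) \<in> M"
        using Suc(1) \<open>Q \<noteq> 0\<close> by blast
      have "(\<lambda>x. (r x * poly Q (x $ i)) * (q z x * (x $ i - z) - 1) + (r x * poly Q (x $ i) - 1)) \<in> M"
        by (intro poly_idealD(3,4)[OF M(1)] q r polynomial_fun.mult polynomial_fun_poly)
      moreover have "(r x * poly Q (x $ i)) * (q z x * (x $ i - z) - 1) + (r x * poly Q (x $ i) - 1)
        = (q z x * r x) * poly P (x $ i) - 1" for x
        by (simp add: Q algebra_simps)
      ultimately have "(\<lambda>x. (q z x * r x) * poly P (x $ i) - 1) \<in> M" by simp
      then show ?case using polynomial_fun.mult[OF q(1)[of z] r(1)] by blast
    qed
    \<comment> \<open>Infinitely many of the \<open>q c\<close> have degree at most a common \<open>n\<close>, so they are dependent.\<close>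
    obtain D where D: "\<And>c. q c \<in> polys_le (D c)"
      using polynomial_fun_degree_bound[OF q(1)] by metis
    obtain n where "infinite {c. D c = n}" using infinite_fibre_of_nat_valued by blast
    then obtain C where C: "finite C" "card C = Suc (card {xs :: 'n list. length xs \<le> n})"
      "C \<subseteq> {c. D c = n}"
      using infinite_arbitrarily_large by metis
    have "\<forall>c\<in>C. \<exists>T. q c = (\<lambda>x. \<Sum>xs | length xs \<le> n. T xs * monomial x xs)"
      using D C(3) by (fastforce simp: polys_le_def)
    then obtain T where T: "\<And>c. c \<in> C \<Longrightarrow> q c = (\<lambda>x. \<Sum>xs | length xs \<le> n. T c xs * monomial x xs)"
      by metis
    obtain a where a: "\<exists>c\<in>C. a c \<noteq> 0" "\<And>xs. length xs \<le> n \<Longrightarrow> (\<Sum>c\<in>C. a c * T c xs) = 0"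
      using homogeneous_system_nontrivial_solution[of "{xs :: 'n list. length xs \<le> n}" C T] C(1,2)
      by auto
    have aq: "(\<Sum>c\<in>C. a c * q c x) = 0" for x
    proof -
      have "(\<Sum>c\<in>C. a c * q c x) = (\<Sum>c\<in>C. \<Sum>xs | length xs \<le> n. a c * T c xs * monomial x xs)"
        by (intro sum.cong refl) (simp add: T sum_distrib_left mult.assoc)
      also have "\<dots> = (\<Sum>xs | length xs \<le> n. (\<Sum>c\<in>C. a c * T c xs) * monomial x xs)"
        by (subst sum.swap) (simp add: sum_distrib_right)
      finally show ?thesis using a(2) by simp
    qed
    \<comment> \<open>\<open>P\<close> is the relation between the \<open>1 / (y - c)\<close>, multiplied by \<open>\<Prod>c\<in>C. y - c\<close>.\<close>
    define E where "E c = (\<Prod>b\<in>C - {c}. [:-b, 1:])" for c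
    define P where "P = (\<Sum>c\<in>C. smult (a c) (E c))"
    have EC: "poly (E c) y * (y - c) = (\<Prod>b\<in>C. y - b)" if "c \<in> C" for c y
      using C(1) that by (subst prod.remove[of _ c]) (auto simp: E_def poly_prod)
    obtain c0 where c0: "c0 \<in> C" "a c0 \<noteq> 0" using a(1) by blast
    have "poly P c0 = (\<Sum>c\<in>C. a c * poly (E c) c0)" by (simp add: P_def poly_sum)
    also have "\<dots> = a c0 * poly (E c0) c0"
      using C(1) c0(1) by (subst sum.remove[of _ c0]) (auto simp: E_def poly_prod intro!: sum.neutral)
    also have "\<dots> \<noteq> 0" using C(1) c0 by (auto simp: E_def poly_prod)
    finally have "P \<noteq> 0" by auto
    have "(\<lambda>x. \<Sum>c\<in>C. (- a c * poly (E c) (x $ i)) * (q c x * (x $ i - c) - 1)) \<in> M"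
      by (intro poly_ideal_sum[OF M(1)] poly_idealD(4)[OF M(1)] q polynomial_fun.mult
          polynomial_fun.const polynomial_fun_poly)
    moreover have "(\<Sum>c\<in>C. (- a c * poly (E c) (x $ i)) * (q c x * (x $ i - c) - 1)) = poly P (x $ i)"
      for x
    proof -
      have "(\<Sum>c\<in>C. (- a c * poly (E c) (x $ i)) * (q c x * (x $ i - c) - 1)) =
        (\<Sum>c\<in>C. a c * poly (E c) (x $ i) - (a c * q c x) * (poly (E c) (x $ i) * (x $ i - c)))"
        by (intro sum.cong) (auto simp: algebra_simps)
      also have "\<dots> = poly P (x $ i) - (\<Sum>c\<in>C. a c * q c x) * (\<Prod>b\<in>C. x $ i - b)"
        by (simp add: sum_subtractf EC P_def poly_sum sum_distrib_right)
      finally show ?thesis by (simp add: aq)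
    qed
    ultimately have "(\<lambda>x. poly P (x $ i)) \<in> M" by simp
    moreover obtain r where "polynomial_fun r" "(\<lambda>x. r x * poly P (x $ i) - 1) \<in> M"
      using unit[OF \<open>P \<noteq> 0\<close>] by blast
    ultimately show False using no_unit[of r "\<lambda>x. poly P (x $ i)"] by blast
  qed
  then obtain c where c: "\<And>i. (\<lambda>x. x $ i - c i) \<in> M" by metis
  define z where "z = (\<chi> i. c i)"
  have eval: "(\<lambda>x. p x - p z) \<in> M" if "polynomial_fun p" for p
    using that
  proof induction
    case (const a)
    then show ?case using poly_idealD(2)[OF M(1)] by simp
  next
    case (coord i)
    then show ?case using c by (simp add: z_def)
  next
    case (add p q)
    then show ?case using poly_idealD(3)[OF M(1) add.IH] by (simp add: algebra_simps)
  next
    case (mult p q)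
    have "(\<lambda>x. q x * (p x - p z) + p z * (q x - q z)) \<in> M"
      by (intro poly_idealD(3,4)[OF M(1)] mult polynomial_fun.const)
    then show ?case by (simp add: algebra_simps)
  qed
  have "p z = 0" if "p \<in> I" for p
  proof (rule ccontr)
    assume nz: "p z \<noteq> 0"
    have p: "p \<in> M" using that M(2) by blast
    then have "(\<lambda>x. p x - (p x - p z)) \<in> M"
      using eval poly_idealD(1)[OF M(1)] poly_ideal_diff[OF M(1)] by blast
    then show False
      using no_unit[of "\<lambda>_. 1 / p z" "\<lambda>_. p z"] nz poly_idealD(2)[OF M(1)]
        polynomial_fun.const[of "1 / p z"] by simp
  qed
  then show ?thesis by blast
qed

text \<open>
  The functions vanishing on \<open>Y\<close> and those vanishing on \<open>Z\<close> generate an ideal without common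
  zero, so \<open>1\<close> is the sum of a function of the first and one of the second kind.
\<close>

lemma separate_disjoint_zariski_closed:
  assumes "zariski_closed Y" "zariski_closed Z" "Y \<inter> Z = {}"
  shows "\<exists>p. polynomial_fun p \<and> (\<forall>x\<in>Y. p x = 0) \<and> (\<forall>x\<in>Z. p x = 1)"
proof -
  obtain P Q where P: "\<forall>p\<in>P. polynomial_fun p" "Y = {x. \<forall>p\<in>P. p x = 0}"
    and Q: "\<forall>p\<in>Q. polynomial_fun p" "Z = {x. \<forall>p\<in>Q. p x = 0}"
    using assms(1,2) unfolding zariski_closed_def by blast
  define J where "J = {f. \<exists>p q. polynomial_fun p \<and> polynomial_fun q \<and>
    (\<forall>x\<in>Y. p x = 0) \<and> (\<forall>x\<in>Z. q x = 0) \<and> f = (\<lambda>x. p x + q x)}"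
  have JI: "f \<in> J" if "polynomial_fun p" "polynomial_fun q" "\<forall>x\<in>Y. p x = 0" "\<forall>x\<in>Z. q x = 0"
    "\<And>x. f x = p x + q x" for f p q
  proof -
    have "f = (\<lambda>x. p x + q x)" using that(5) by auto
    with that show ?thesis unfolding J_def by blast
  qed
  have "poly_ideal J"
    unfolding poly_ideal_def
  proof (intro conjI ballI allI impI)
    show "J \<subseteq> Collect polynomial_fun" by (auto simp: J_def intro: polynomial_fun.add)
    show "(\<lambda>_. 0) \<in> J"
      using polynomial_fun.const[of 0] by (auto simp: J_def intro!: exI[of _ "\<lambda>_. 0"])
  next
    fix f g assume "f \<in> J" "g \<in> J"
    then obtain p q p' q' where *: "polynomial_fun p" "polynomial_fun q"
      "polynomial_fun p'" "polynomial_fun q'" "\<forall>x\<in>Y. p x = 0" "\<forall>x\<in>Z. q x = 0"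
      "\<forall>x\<in>Y. p' x = 0" "\<forall>x\<in>Z. q' x = 0" "f = (\<lambda>x. p x + q x)" "g = (\<lambda>x. p' x + q' x)"
      unfolding J_def by blast
    then show "(\<lambda>x. f x + g x) \<in> J"
      by (intro JI[of "\<lambda>x. p x + p' x" "\<lambda>x. q x + q' x"]) (auto intro: polynomial_fun.add)
  next
    fix s f :: "complex ^ 'a \<Rightarrow> complex" assume s: "polynomial_fun s" and "f \<in> J"
    then obtain p q where *: "polynomial_fun p" "polynomial_fun q"
      "\<forall>x\<in>Y. p x = 0" "\<forall>x\<in>Z. q x = 0" "f = (\<lambda>x. p x + q x)"
      unfolding J_def by blast
    then show "(\<lambda>x. s x * f x) \<in> J"
      using s by (intro JI[of "\<lambda>x. s x * p x" "\<lambda>x. s x * q x"])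
        (auto simp: distrib_left intro: polynomial_fun.mult)
  qed
  moreover have "\<nexists>z. \<forall>p\<in>J. p z = 0"
  proof
    assume "\<exists>z. \<forall>p\<in>J. p z = 0"
    then obtain z where z: "\<And>p. p \<in> J \<Longrightarrow> p z = 0" by blast
    have "p \<in> J" if "p \<in> P" for p
      using that P by (intro JI[of p "\<lambda>_. 0"]) (auto intro: polynomial_fun.const)
    moreover have "q \<in> J" if "q \<in> Q" for q
      using that Q by (intro JI[of "\<lambda>_. 0" q]) (auto intro: polynomial_fun.const)
    ultimately have "z \<in> Y \<inter> Z" using P(2) Q(2) z by blast
    with assms(3) show False by blast
  qed
  ultimately have "(\<lambda>_. 1) \<in> J" using weak_nullstellensatz by blast
  then obtain p q where *: "polynomial_fun p" "\<forall>x\<in>Y. p x = 0" "\<forall>x\<in>Z. q x = 0" "(\<lambda>_. 1) = (\<lambda>x. p x + q x)"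
    unfolding J_def by blast
  have "p x = 1" if "x \<in> Z" for x using fun_cong[OF *(4), of x] *(3) that by auto
  with * show ?thesis by blast
qed

section \<open>Extending invariant functions to invariant polynomials\<close>

definition conj_transpose :: "complex ^ 'n ^ 'n \<Rightarrow> complex ^ 'n ^ 'n" where
  "conj_transpose A = (\<chi> i j. cnj (A $ j $ i))"

text \<open>
  \<open>word_coeff A\<close> is the matrix of the tensor power of \<open>A\<close> of degree \<open>length xs = length ys\<close>;
  only pairs of words of equal length are of interest.
\<close>

definition word_coeff :: "complex ^ 'n ^ 'n \<Rightarrow> 'n list \<Rightarrow> 'n list \<Rightarrow> complex" where
  "word_coeff A xs ys = prod_list (map2 (\<lambda>i j. A $ i $ j) xs ys)"

definition form :: "nat \<Rightarrow> ('n list \<Rightarrow> complex) \<Rightarrow> complex ^ 'n::finite \<Rightarrow> complex" where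
  "form d T x = (\<Sum>xs | length xs = d. T xs * monomial x xs)"

text \<open>
  The coefficients of the form \<open>x \<mapsto> form d T (A *v x)\<close>, simultaneously in all degrees \<open>d\<close>.
\<close>

definition pullback :: "complex ^ 'n ^ 'n \<Rightarrow> ('n list \<Rightarrow> complex) \<Rightarrow> 'n::finite list \<Rightarrow> complex" where
  "pullback A T ys = (\<Sum>xs | length xs = length ys. T xs * word_coeff A xs ys)"

lemma sum_words_Suc:
  fixes f :: "'n::finite list \<Rightarrow> complex"
  shows "(\<Sum>ys | length ys = Suc d. f ys) = (\<Sum>j\<in>UNIV. \<Sum>ys | length ys = d. f (j # ys))"
  by (subst sum.cartesian_product)
    (auto intro!: sum.reindex_bij_witness[of _ "\<lambda>(j, ys). j # ys" "\<lambda>ys. (hd ys, tl ys)"]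
      simp: length_Suc_conv)

lemma monomial_matrix:
  "monomial (A *v x) xs = (\<Sum>ys | length ys = length xs. word_coeff A xs ys * monomial x ys)"
proof (induction xs)
  case Nil
  then show ?case by (simp add: word_coeff_def)
next
  case (Cons i xs)
  then show ?case
    by (simp add: sum_words_Suc word_coeff_def matrix_vector_mult_def sum_product mult_ac)
qed

lemma cnj_word_coeff:
  "length xs = length ys \<Longrightarrow> cnj (word_coeff A xs ys) = word_coeff (conj_transpose A) ys xs"
  by (induction xs ys rule: list_induct2) (auto simp: word_coeff_def conj_transpose_def)

lemma form_matrix: "form d T (A *v x) = form d (pullback A T) x"
proof -
  have "form d T (A *v x) = (\<Sum>xs | length xs = d. \<Sum>ys | length ys = d.
      T xs * word_coeff A xs ys * monomial x ys)"
    by (auto simp: form_def monomial_matrix sum_distrib_left mult.assoc intro!: sum.cong)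
  also have "\<dots> = form d (pullback A T) x"
    by (subst sum.swap) (auto simp: form_def pullback_def sum_distrib_right intro!: sum.cong)
  finally show ?thesis .
qed

lemma pullback_adjoint:
  "(\<Sum>xs | length xs = d. pullback A T xs * cnj (U xs)) =
   (\<Sum>xs | length xs = d. T xs * cnj (pullback (conj_transpose A) U xs))"
proof -
  have "(\<Sum>ys | length ys = d. pullback A T ys * cnj (U ys)) =
    (\<Sum>ys | length ys = d. \<Sum>xs | length xs = d. T xs * (cnj (U ys) * word_coeff A xs ys))"
    by (auto simp: pullback_def sum_distrib_left sum_distrib_right mult_ac intro!: sum.cong)
  also have "\<dots> = (\<Sum>xs | length xs = d. \<Sum>ys | length ys = d.
      T xs * cnj (U ys * word_coeff (conj_transpose A) ys xs))"
    by (subst sum.swap) (auto intro!: sum.cong simp flip: cnj_word_coeff)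
  also have "\<dots> = (\<Sum>xs | length xs = d. T xs * cnj (pullback (conj_transpose A) U xs))"
    by (auto simp: pullback_def sum_distrib_left intro!: sum.cong)
  finally show ?thesis .
qed

lemma polynomial_fun_form: "polynomial_fun (form d T)"
  unfolding form_def[abs_def]
  by (intro polynomial_fun_sum polynomial_fun.mult polynomial_fun.const polynomial_fun_monomial)

lemma monomial_scale: "monomial (t *s x) xs = t ^ length xs * monomial x xs"
  by (induction xs) auto

lemma form_scale: "form d T (t *s x) = t ^ d * form d T x"
  by (auto simp: form_def monomial_scale sum_distrib_left mult_ac intro!: sum.cong)

text \<open>
  This replaces the Reynolds operator of a reductive group by an orthogonal projection, which only
  needs the acting set of matrices to be closed under conjugate transposition. Let \<open>T\<close> be
  coefficients of \<open>p\<close> and \<open>W\<close> the space of coefficients of polynomials vanishing on \<open>X\<close>. Since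
  \<open>X\<close> is stable, \<open>W\<close> is stable under all \<open>pullback A\<close>, and since the adjoint of \<open>pullback A\<close> is
  \<open>pullback (conj_transpose A)\<close>, so is the orthogonal complement of \<open>W\<close>. Let \<open>T0\<close> be the
  component of \<open>T\<close> in this complement; it defines the same function on \<open>X\<close>. The difference
  \<open>V = pullback A T0 - T0\<close> lies in the complement, but also in \<open>W\<close> because \<open>p\<close> is invariant on
  \<open>X\<close>. Hence \<open>V = 0\<close>, and the forms with coefficients \<open>T0\<close> are invariant.
\<close>

theorem invariant_polynomial_extension:
  fixes G :: "(complex ^ 'n ^ 'n::finite) set"
  assumes p: "polynomial_fun p"
    and adj: "\<And>A. A \<in> G \<Longrightarrow> conj_transpose A \<in> G"
    and X: "\<And>A x. A \<in> G \<Longrightarrow> x \<in> X \<Longrightarrow> A *v x \<in> X"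
    and inv: "\<And>A x. A \<in> G \<Longrightarrow> x \<in> X \<Longrightarrow> p (A *v x) = p x"
  obtains f D where
    "\<And>d. polynomial_fun (f d)"
    "\<And>d t x. f d (t *s x) = t ^ d * f d x"
    "\<And>d A x. A \<in> G \<Longrightarrow> d \<le> D \<Longrightarrow> f d (A *v x) = f d x"
    "\<And>x. x \<in> X \<Longrightarrow> p x = (\<Sum>d\<le>D. f d x)"
proof -
  obtain D T where "p = (\<lambda>x. \<Sum>xs | length xs \<le> D. T xs * monomial x xs)"
    using polynomial_fun_degree_bound[OF p] unfolding polys_le_def by blast
  then have pT: "p x = (\<Sum>d\<le>D. form d T x)" for x
    by (simp add: sum_words_by_length form_def)
  define W where "W = {U. \<forall>x\<in>X. (\<Sum>d\<le>D. form d U x) = 0}"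
  have form_add: "form d (\<lambda>l. U l + V l) x = form d U x + form d V x"
    and form_diff: "form d (\<lambda>l. U l - V l) x = form d U x - form d V x"
    and form_mult: "form d (\<lambda>l. c * U l) x = c * form d U x" for d U V c x
    by (simp_all add: form_def sum.distrib sum_subtractf sum_distrib_left algebra_simps)
  obtain w where w: "w \<in> W" 
    "\<And>u. u \<in> W \<Longrightarrow> (\<Sum>l | length l \<le> D. (T l - w l) * cnj (u l)) = 0"
    using orthogonal_projection[of "{l :: 'n list. length l \<le> D}" W T]
    by (auto simp: W_def form_add form_mult sum.distrib simp flip: sum_distrib_left)
      (auto simp: form_def)
  define T0 where "T0 l = T l - w l" for l
  have T0: "p x = (\<Sum>d\<le>D. form d T0 x)" if "x \<in> X" for x
    using that w(1) by (simp add: T0_def[abs_def] form_diff sum_subtractf pT W_def)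
  have fixed: "pullback A T0 l = T0 l" if A: "A \<in> G" and l: "length l \<le> D" for A l
  proof -
    define V where "V l = pullback A T0 l - T0 l" for l
    have V: "V \<in> W"
    proof -
      have "(\<Sum>d\<le>D. form d V x) = p (A *v x) - p x" if "x \<in> X" for x
        using T0[OF that] T0[OF X[OF A that]]
        by (simp add: V_def[abs_def] form_diff sum_subtractf form_matrix)
      then show ?thesis using inv[OF A] by (simp add: W_def)
    qed
    then have V': "pullback (conj_transpose A) V \<in> W"
      using X[OF adj[OF A]] by (simp add: W_def flip: form_matrix)
    have "(\<Sum>l | length l \<le> D. V l * cnj (V l)) =
      (\<Sum>l | length l \<le> D. pullback A T0 l * cnj (V l)) - (\<Sum>l | length l \<le> D. T0 l * cnj (V l))"
      by (subst V_def) (simp add: algebra_simps sum_subtractf)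
    also have "\<dots> = (\<Sum>l | length l \<le> D. T0 l * cnj (pullback (conj_transpose A) V l)) -
        (\<Sum>l | length l \<le> D. T0 l * cnj (V l))"
      by (simp only: sum_words_by_length pullback_adjoint)
    also have "\<dots> = 0" using w(2)[OF V] w(2)[OF V'] by (simp add: T0_def)
    finally have "of_real (\<Sum>l | length l \<le> D. (cmod (V l))\<^sup>2) = (0 :: complex)"
      by (simp only: complex_norm_square of_real_sum)
    then have "(\<Sum>l | length l \<le> D. (cmod (V l))\<^sup>2) = 0" by (simp only: of_real_eq_0_iff)
    then have "V l = 0" using l by (subst (asm) sum_nonneg_eq_0_iff) auto
    then show ?thesis by (simp add: V_def)
  qed
  show thesis
  proof (rule that[of "\<lambda>d. form d T0" D])
    show "form d T0 (A *v x) = form d T0 x" if "A \<in> G" "d \<le> D" for d A x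
      using fixed[OF that(1)] that(2) by (simp add: form_matrix) (simp add: form_def)
  qed (use T0 in \<open>auto simp: polynomial_fun_form form_scale\<close>)
qed

section \<open>The action of triples of matrices on tensors\<close>

text \<open>
  The Kronecker product: the matrix of the action on tensors.
\<close>

definition kron :: "('m::finite) matrix3 \<Rightarrow> complex ^ ('m \<times> 'm \<times> 'm) ^ ('m \<times> 'm \<times> 'm)" where
  "kron = (\<lambda>(g1, g2, g3). \<chi> p q. g1 $ fst p $ fst q * g2 $ fst (snd p) $ fst (snd q) *
     g3 $ snd (snd p) $ snd (snd q))"

definition scalar_mult :: "complex \<Rightarrow> complex ^ 'm ^ 'm \<Rightarrow> complex ^ 'm ^ 'm" where
  "scalar_mult c A = (\<chi> i j. c * A $ i $ j)"

lemma sum_triples: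
  fixes f :: "'a::finite \<times> 'a \<times> 'a \<Rightarrow> complex"
  shows "(\<Sum>p\<in>UNIV. f p) = (\<Sum>a\<in>UNIV. \<Sum>b\<in>UNIV. \<Sum>c\<in>UNIV. f (a, b, c))"
  by (simp add: sum.cartesian_product case_prod_unfold)

lemma act_eq_kron: "act g w = kron g *v w"
  by (simp add: vec_eq_iff act_def kron_def matrix_vector_mult_def sum_triples case_prod_unfold)

lemma sum_triples_product:
  fixes A B C :: "'a::finite \<Rightarrow> complex"
  shows "(\<Sum>a\<in>UNIV. \<Sum>b\<in>UNIV. \<Sum>c\<in>UNIV. A a * (B b * C c)) = sum A UNIV * (sum B UNIV * sum C UNIV)"
  by (simp only: sum_distrib_left[symmetric] sum_distrib_right[symmetric])

lemma kron_mult: "kron (g1, g2, g3) ** kron (h1, h2, h3) = kron (g1 ** h1, g2 ** h2, g3 ** h3)"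
proof -
  have "(\<Sum>a\<in>UNIV. \<Sum>b\<in>UNIV. \<Sum>c\<in>UNIV. g1 $ i $ a * g2 $ j $ b * g3 $ k $ c *
      (h1 $ a $ i' * h2 $ b $ j' * h3 $ c $ k')) =
    (\<Sum>a\<in>UNIV. g1 $ i $ a * h1 $ a $ i') * ((\<Sum>b\<in>UNIV. g2 $ j $ b * h2 $ b $ j') *
    (\<Sum>c\<in>UNIV. g3 $ k $ c * h3 $ c $ k'))" for i j k i' j' k'
    by (subst sum_triples_product[symmetric]) (intro sum.cong refl, simp)
  then show ?thesis
    by (simp add: vec_eq_iff kron_def matrix_matrix_mult_def sum_triples mult.assoc)
qed

lemma act_act: "act (g1, g2, g3) (act (h1, h2, h3) w) = act (g1 ** h1, g2 ** h2, g3 ** h3) w"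
  by (simp add: act_eq_kron matrix_vector_mul_assoc kron_mult)

lemma act_one: "act (mat 1, mat 1, mat 1) w = w"
proof -
  have "kron (mat 1, mat 1, mat 1) = (mat 1 :: complex ^ ('a \<times> 'a \<times> 'a) ^ ('a \<times> 'a \<times> 'a))"
    by (auto simp: vec_eq_iff kron_def mat_def)
  then show ?thesis by (simp add: act_eq_kron)
qed

lemma act_scale: "act g (c *s w) = c *s act g w"
  by (simp add: act_eq_kron vector_scalar_commute)

lemma act_scalar_mult: 
  "act (scalar_mult a g1, scalar_mult b g2, scalar_mult c g3) w = (a * b * c) *s act (g1, g2, g3) w"
  by (simp add: vec_eq_iff act_def scalar_mult_def sum_distrib_left mult_ac)

lemma scalar_mult_one [simp]: "scalar_mult 1 g = g"
  by (simp add: scalar_mult_def vec_eq_iff)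

lemma det_scalar_mult: "det (scalar_mult c g) = c ^ CARD('m) * det g"
  for g :: "complex ^ 'm ^ 'm::finite"
proof -
  have "scalar_mult c g = (\<chi> i. c *s (g $ i))" by (simp add: scalar_mult_def vec_eq_iff)
  then show ?thesis using det_rows_mul[of "\<lambda>_. c" "\<lambda>i. g $ i"] by simp
qed

lemma conj_transpose_kron:
  "conj_transpose (kron (g1, g2, g3)) = kron (conj_transpose g1, conj_transpose g2, conj_transpose g3)"
  by (simp add: vec_eq_iff conj_transpose_def kron_def)

lemma det_conj_transpose: "det (conj_transpose g) = cnj (det g)"
proof -
  have "det (conj_transpose g) = det (\<chi> i j. cnj (g $ i $ j))"
    by (subst det_transpose[symmetric]) (simp add: conj_transpose_def transpose_def)
  also have "\<dots> = cnj (det g)" by (simp add: det_def)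
  finally show ?thesis .
qed

lemma exists_nth_root: "\<exists>t::complex. t ^ n = c" if "n > 0" "c \<noteq> 0"
  using card_nth_roots[OF that(2,1)] that(1) by (metis (mono_tags) card.empty empty_Collect_eq less_irrefl)

text \<open>
  Over the complex numbers the determinant can be split off as a scalar, so that the general
  linear orbit of a tensor consists of the scalar multiples of its special linear orbit.
\<close>

lemma GL_factor:
  fixes g :: "complex ^ 'm ^ 'm::finite"
  assumes "invertible g"
  obtains t h where "t ^ CARD('m) = det g" "det h = 1" "g = scalar_mult t h"
proof -
  have "det g \<noteq> 0" using assms by (simp add: invertible_det_nz)
  then obtain t where t: "t ^ CARD('m) = det g" using exists_nth_root[of "CARD('m)"] by auto
  then have "t \<noteq> 0" using \<open>det g \<noteq> 0\<close> by (auto simp: power_0_left)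
  with t \<open>det g \<noteq> 0\<close> show thesis
    by (intro that[of t "scalar_mult (inverse t) g"])
      (auto simp: det_scalar_mult power_inverse, simp add: scalar_mult_def vec_eq_iff)
qed

lemma GL3_factor:
  fixes g :: "('m::finite) matrix3"
  assumes "g \<in> GL3"
  obtains t h where "h \<in> SL3" "t ^ CARD('m) = chi g" "\<And>w. act g w = t *s act h w"
proof -
  obtain g1 g2 g3 where g: "g = (g1, g2, g3)" by (cases g) auto
  with assms have "invertible g1" "invertible g2" "invertible g3" by (auto simp: GL3_def)
  then obtain t1 h1 t2 h2 t3 h3 where
    "t1 ^ CARD('m) = det g1" "det h1 = 1" "g1 = scalar_mult t1 h1"
    "t2 ^ CARD('m) = det g2" "det h2 = 1" "g2 = scalar_mult t2 h2"
    "t3 ^ CARD('m) = det g3" "det h3 = 1" "g3 = scalar_mult t3 h3"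
    by (metis GL_factor)
  then show thesis
    by (intro that[of "(h1, h2, h3)" "t1 * t2 * t3"])
      (simp_all add: SL3_def chi_def g act_scalar_mult power_mult_distrib)
qed

lemma chi_nonzero: "g \<in> GL3 \<Longrightarrow> chi g \<noteq> 0"
  by (auto simp: GL3_def chi_def invertible_det_nz)

lemma SL3_subset_GL3: "SL3 \<subseteq> GL3"
  by (auto simp: SL3_def GL3_def invertible_det_nz)

lemma SL3_comp: "g \<in> SL3 \<Longrightarrow> h \<in> SL3 \<Longrightarrow> \<exists>k\<in>SL3. \<forall>w. act g (act h w) = act k w"
proof -
  assume "g \<in> SL3" "h \<in> SL3"
  then obtain g1 g2 g3 h1 h2 h3 where "g = (g1, g2, g3)" "h = (h1, h2, h3)"
    "(g1 ** h1, g2 ** h2, g3 ** h3) \<in> SL3"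
    by (cases g; cases h) (auto simp: SL3_def det_mul)
  then show ?thesis using act_act by metis
qed

lemma GL3_comp: "g \<in> GL3 \<Longrightarrow> h \<in> GL3 \<Longrightarrow> \<exists>k\<in>GL3. \<forall>w. act g (act h w) = act k w"
proof -
  assume "g \<in> GL3" "h \<in> GL3"
  then obtain g1 g2 g3 h1 h2 h3 where "g = (g1, g2, g3)" "h = (h1, h2, h3)"
    "(g1 ** h1, g2 ** h2, g3 ** h3) \<in> GL3"
    by (cases g; cases h) (auto simp: GL3_def invertible_mult)
  then show ?thesis using act_act by metis
qed

lemma SL3_inverse:
  assumes "g \<in> SL3"
  obtains h where "h \<in> SL3" "\<And>w. act h (act g w) = w"
proof -
  obtain g1 g2 g3 where g: "g = (g1, g2, g3)" by (cases g) auto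
  have *: "\<exists>h. det h = 1 \<and> h ** k = mat 1" if "det k = 1" for k :: "complex ^ 'a ^ 'a"
  proof -
    have "invertible k" using that by (simp add: invertible_det_nz)
    then obtain h where "h ** k = mat 1" by (auto simp: invertible_def)
    moreover from this have "det h = 1" using that by (metis det_I det_mul mult_1_right)
    ultimately show ?thesis by blast
  qed
  obtain h1 h2 h3 where "det h1 = 1" "h1 ** g1 = mat 1" "det h2 = 1" "h2 ** g2 = mat 1"
    "det h3 = 1" "h3 ** g3 = mat 1"
    using *[of g1] *[of g2] *[of g3] assms by (auto simp: SL3_def g)
  then show thesis
    by (intro that[of "(h1, h2, h3)"]) (simp_all add: SL3_def g act_act act_one)
qed

section \<open>The orbit closure\<close>

lemma mem_orbit_closure:
  "x \<in> orbit_closure w \<longleftrightarrow>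
    (\<forall>p. polynomial_fun p \<longrightarrow> (\<forall>g\<in>GL3. p (act g w) = 0) \<longrightarrow> p x = 0)" (is "_ \<longleftrightarrow> ?R x")
proof
  assume "x \<in> orbit_closure w"
  moreover have "zariski_closed {x. ?R x}"
    unfolding zariski_closed_def
    by (rule exI[of _ "{p. polynomial_fun p \<and> (\<forall>g\<in>GL3. p (act g w) = 0)}"]) auto
  ultimately show "?R x"
    unfolding orbit_closure_def hull_def by blast
next
  assume R: "?R x"
  show "x \<in> orbit_closure w"
    unfolding orbit_closure_def hull_def
  proof (intro InterI, clarify)
    fix Z assume "zariski_closed Z" "(\<lambda>g. act g w) ` GL3 \<subseteq> Z"
    then show "x \<in> Z" using R unfolding zariski_closed_def by blast
  qed
qed

lemma orbit_subset_closure: "g \<in> GL3 \<Longrightarrow> act g w \<in> orbit_closure w"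
  by (simp add: mem_orbit_closure)

lemma self_in_orbit_closure: "w \<in> orbit_closure w"
  using orbit_subset_closure[of "(mat 1, mat 1, mat 1)" w] by (simp add: act_one GL3_def invertible_det_nz)

lemma act_orbit_closure: "act g x \<in> orbit_closure w" if "g \<in> GL3" "x \<in> orbit_closure w"
  unfolding mem_orbit_closure
proof (intro allI impI)
  fix p assume p: "polynomial_fun p" "\<forall>g\<in>GL3. p (act g w) = 0"
  have "polynomial_fun (\<lambda>y. p (act g y))" using p(1) by (simp add: act_eq_kron polynomial_fun_matrix)
  moreover have "\<forall>h\<in>GL3. p (act g (act h w)) = 0" using p(2) GL3_comp[OF that(1)] by metis
  ultimately show "p (act g x) = 0"
    using mem_orbit_closure[THEN iffD1, OF that(2), rule_format, of "\<lambda>y. p (act g y)"] by blast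
qed

text \<open>
  For \<open>t \<noteq> 0\<close> the scaling is the action of a scalar matrix; the value \<open>t = 0\<close> follows by
  continuity.
\<close>

lemma scale_orbit_closure: "t *s x \<in> orbit_closure w" if "x \<in> orbit_closure w"
proof -
  have nz: "t *s y \<in> orbit_closure w" if "t \<noteq> 0" "y \<in> orbit_closure w" for t y
  proof -
    have "(scalar_mult t (mat 1), mat 1, mat 1) \<in> GL3"
      using that(1) by (simp add: GL3_def invertible_det_nz det_scalar_mult)
    from act_orbit_closure[OF this that(2)] show ?thesis
      using act_scalar_mult[of t "mat 1" 1 "mat 1" 1 "mat 1" y] by (simp add: act_one)
  qed
  show ?thesis
    unfolding mem_orbit_closure
  proof (intro allI impI)
    fix p assume p: "polynomial_fun p" "\<forall>g\<in>GL3. p (act g w) = 0"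
    have "continuous_on (closure (- {0})) (\<lambda>s. p (s *s x))"
      by (rule continuous_on_compose2[OF continuous_on_polynomial_fun[OF p(1)]])
        (auto intro!: continuous_intros simp: vector_scalar_mult_def)
    moreover have "p (s *s x) = 0" if "s \<in> - {0}" for s
      using nz[of s x] p that \<open>x \<in> orbit_closure w\<close> by (auto simp: mem_orbit_closure)
    moreover have "t \<in> closure (- {0})" by (simp add: closure_complement)
    ultimately show "p (t *s x) = 0" by (rule continuous_constant_on_closure)
  qed
qed

section \<open>Scalars preserving the special linear orbit\<close>

text \<open>
  This group links both sides of the theorem: its order is the period up to the factor \<open>m\<close>, and
  it is cut out by the equations \<open>z ^ d = 1\<close> for the degrees \<open>d\<close> of invariants.
\<close>

definition orbit_scalars :: "('m::finite) tensor \<Rightarrow> complex set" where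
  "orbit_scalars w = {z. z \<noteq> 0 \<and> z *s w \<in> (\<lambda>g. act g w) ` SL3}"

text \<open>
  Moving the scalar \<open>z\<close> of an equation \<open>act h w = z *s w\<close> with \<open>h \<in> SL3\<close> into the first matrix
  gives an element of the stabilizer with determinant product \<open>z\<close> to the power \<open>- m\<close>. Conversely, an
  element of the stabilizer with this value of \<open>chi\<close> has the form of a scalar \<open>t\<close> times some
  \<open>h \<in> SL3\<close>. Then \<open>t * z\<close> is an \<open>m\<close>-th root of unity, hence multiplication by it stays in the
  special linear group and corrects \<open>h\<close> to an element that maps \<open>w\<close> to \<open>z *s w\<close>.
\<close>

lemma orbit_scalars_iff_chi:
  fixes w :: "('m::finite) tensor"
  assumes "z \<noteq> 0"
  shows "z \<in> orbit_scalars w \<longleftrightarrow> inverse (z ^ CARD('m)) \<in> chi ` stab w"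
proof
  assume "z \<in> orbit_scalars w"
  then obtain h1 h2 h3 where h: "(h1, h2, h3) \<in> SL3" "act (h1, h2, h3) w = z *s w"
    by (auto simp: orbit_scalars_def)
  define g where "g = (scalar_mult (inverse z) h1, h2, h3)"
  have "act g w = w"
    using act_scalar_mult[of "inverse z" h1 1 h2 1 h3 w] h(2) assms by (simp add: g_def)
  then have "g \<in> stab w"
    using h(1) assms by (auto simp: stab_def g_def GL3_def SL3_def invertible_det_nz det_scalar_mult)
  moreover have "chi g = inverse (z ^ CARD('m))"
    using h(1) by (simp add: g_def chi_def SL3_def det_scalar_mult power_inverse)
  ultimately show "inverse (z ^ CARD('m)) \<in> chi ` stab w" by force
next
  assume "inverse (z ^ CARD('m)) \<in> chi ` stab w"
  then obtain g where g: "g \<in> GL3" "act g w = w" "chi g = inverse (z ^ CARD('m))"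
    by (auto simp: stab_def)
  obtain t h1 h2 h3 where h: "(h1, h2, h3) \<in> SL3" "t ^ CARD('m) = chi g" "t *s act (h1, h2, h3) w = w"
    using GL3_factor[OF g(1)] g(2) by (metis prod_cases3)
  have root: "(t * z) ^ CARD('m) = 1" using h(2) g(3) assms by (simp add: power_mult_distrib)
  have "act (scalar_mult (t * z) h1, h2, h3) w = z *s w"
  proof -
    have "act (scalar_mult (t * z) h1, h2, h3) w = z *s (t *s act (h1, h2, h3) w)"
      using act_scalar_mult[of "t * z" h1 1 h2 1 h3 w] by (simp add: mult.commute)
    then show ?thesis by (simp only: h(3))
  qed
  moreover have "(scalar_mult (t * z) h1, h2, h3) \<in> SL3"
    using h(1) root by (simp add: SL3_def det_scalar_mult)
  ultimately show "z \<in> orbit_scalars w" using assms by (force simp: orbit_scalars_def)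
qed

text \<open>
  The map \<open>z \<mapsto> z\<close> to the power \<open>- m\<close> is onto \<open>chi ` stab w\<close>, and its fibres consist of \<open>m\<close> roots.
  If the groups are infinite, both cardinalities are \<open>0\<close>.
\<close>

lemma card_orbit_scalars: "card (orbit_scalars w) = CARD('m) * stabilizer_period w"
  for w :: "('m::finite) tensor"
proof -
  have nz: "c \<noteq> 0" if "c \<in> chi ` stab w" for c using that chi_nonzero by (auto simp: stab_def)
  have root_nz: "z \<noteq> 0" if "c \<in> chi ` stab w" "z ^ CARD('m) = inverse c" for z c
    using that nz by (auto simp: power_0_left)
  have eq: "orbit_scalars w = (\<Union>c\<in>chi ` stab w. {z. z ^ CARD('m) = inverse c})"
  proof (intro set_eqI iffI)
    fix z assume "z \<in> orbit_scalars w"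
    moreover from this have "z \<noteq> 0" by (simp add: orbit_scalars_def)
    ultimately show "z \<in> (\<Union>c\<in>chi ` stab w. {z. z ^ CARD('m) = inverse c})"
      using orbit_scalars_iff_chi by (intro UN_I[of "inverse (z ^ CARD('m))"]) auto
  next
    fix z assume "z \<in> (\<Union>c\<in>chi ` stab w. {z. z ^ CARD('m) = inverse c})"
    then obtain c where "c \<in> chi ` stab w" "z ^ CARD('m) = inverse c" by blast
    then show "z \<in> orbit_scalars w" using orbit_scalars_iff_chi root_nz by (metis inverse_inverse_eq)
  qed
  show ?thesis
  proof (cases "finite (chi ` stab w)")
    case True
    have "card (orbit_scalars w) = (\<Sum>c\<in>chi ` stab w. card {z::complex. z ^ CARD('m) = inverse c})"
      unfolding eq using True by (intro card_UN_disjoint) (auto intro!: finite_nth_roots)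
    also have "\<dots> = (\<Sum>c\<in>chi ` stab w. CARD('m))"
      using nz by (intro sum.cong card_nth_roots) auto
    finally show ?thesis by (simp add: stabilizer_period_def)
  next
    case False
    have "chi ` stab w \<subseteq> (\<lambda>z. inverse (z ^ CARD('m))) ` orbit_scalars w"
    proof
      fix c assume c: "c \<in> chi ` stab w"
      then obtain z where "z ^ CARD('m) = inverse c"
        using exists_nth_root[of "CARD('m)" "inverse c"] nz by auto
      then show "c \<in> (\<lambda>z. inverse (z ^ CARD('m))) ` orbit_scalars w"
        using c unfolding eq by (intro image_eqI[of _ _ z]) auto
    qed
    then have "infinite (orbit_scalars w)" using False finite_surj by blast
    then show ?thesis using False by (simp add: stabilizer_period_def)
  qed
qed

text \<open>
  An invariant that does not vanish on the closure does not vanish at \<open>w\<close> either, since its values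
  on the dense orbit are multiples of its value at \<open>w\<close>. Comparing its values at \<open>w\<close> and at
  \<open>z *s w\<close>, which lie in the same special linear orbit, gives \<open>z ^ d = 1\<close>.
\<close>

lemma degree_kills_orbit_scalars:
  assumes "d \<in> degree_monoid w" "z \<in> orbit_scalars w"
  shows "z ^ d = 1"
proof -
  let ?Z = "orbit_closure w"
  obtain f x0 where f: "f \<in> invariants w d" and x0: "x0 \<in> ?Z" "f x0 \<noteq> 0"
    using assms(1) by (auto simp: degree_monoid_def)
  obtain p where p: "polynomial_fun p" "f = restrict p ?Z"
    using f by (auto simp: invariants_def regular_functions_def)
  have inv: "f (act g x) = f x" if "g \<in> SL3" "x \<in> ?Z" for g x
    using f that by (auto simp: invariants_def)
  have hom: "f (t *s x) = t ^ d * f x" if "x \<in> ?Z" for t x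
    using f that by (auto simp: invariants_def)
  have "f w \<noteq> 0"
  proof
    assume "f w = 0"
    have "p (act g w) = 0" if g: "g \<in> GL3" for g
    proof -
      obtain t h where h: "h \<in> SL3" "act g w = t *s act h w" using GL3_factor[OF g] by metis
      have "p (act g w) = f (act g w)" using orbit_subset_closure[OF g] by (simp add: p(2))
      also have "\<dots> = t ^ d * f w"
        using h hom inv self_in_orbit_closure orbit_subset_closure SL3_subset_GL3 by (metis subsetD)
      finally show ?thesis using \<open>f w = 0\<close> by simp
    qed
    then have "p x0 = 0" using x0(1) p(1) by (simp add: mem_orbit_closure)
    then show False using x0 by (simp add: p(2))
  qed
  obtain h where "h \<in> SL3" "act h w = z *s w" using assms(2) by (auto simp: orbit_scalars_def)
  then have "f w = z ^ d * f w" using inv hom self_in_orbit_closure by metis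
  with \<open>f w \<noteq> 0\<close> show ?thesis by simp
qed

lemma zariski_closed_scale:
  assumes "zariski_closed Y" "z \<noteq> 0"
  shows "zariski_closed ((*s) z ` Y)"
proof -
  obtain P where P: "\<forall>p\<in>P. polynomial_fun p" "Y = {x. \<forall>p\<in>P. p x = 0}"
    using assms(1) unfolding zariski_closed_def by blast
  have "(*s) z ` Y = {x. inverse z *s x \<in> Y}"
  proof (intro set_eqI iffI CollectI)
    fix x assume "x \<in> {x. inverse z *s x \<in> Y}"
    moreover have "x = z *s (inverse z *s x)" using assms(2) by simp
    ultimately show "x \<in> (*s) z ` Y" by blast
  qed (use assms(2) in auto)
  also have "\<dots> = {x. \<forall>q\<in>(\<lambda>p x. p (inverse z *s x)) ` P. q x = 0}" by (simp add: P(2))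
  finally have "(*s) z ` Y = {x. \<forall>q\<in>(\<lambda>p x. p (inverse z *s x)) ` P. q x = 0}" .
  moreover have "\<forall>q\<in>(\<lambda>p x. p (inverse z *s x)) ` P. polynomial_fun q"
    using P(1) by (auto intro: polynomial_fun_scale)
  ultimately show ?thesis unfolding zariski_closed_def by (intro exI conjI)
qed

text \<open>
  If \<open>z *s w\<close> is outside the closed orbit \<open>S\<close> of \<open>w\<close>, then \<open>S\<close> and its multiple by \<open>z\<close> are
  disjoint closed stable sets. A polynomial separating them is invariant on their union, because it
  is constant on each, so it can be taken to be a sum of invariant forms. A form of degree \<open>d\<close> that
  is nonzero at \<open>w\<close> puts \<open>d\<close> into the degree monoid, hence takes the same value at \<open>z *s w\<close>,
  and so do those that vanish at \<open>w\<close>: the polynomial does not separate the two points.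
\<close>

lemma orbit_scalar_if_degrees_kill:
  fixes w :: "('m::finite) tensor"
  assumes "polystable w" "z \<noteq> 0" and kill: "\<And>d. d \<in> degree_monoid w \<Longrightarrow> z ^ d = 1"
  shows "z \<in> orbit_scalars w"
proof (rule ccontr)
  assume contra: "z \<notin> orbit_scalars w"
  define S where "S = (\<lambda>g. act g w) ` SL3"
  have one: "(mat 1, mat 1, mat 1) \<in> SL3" by (simp add: SL3_def)
  have wS: "w \<in> S" unfolding S_def using one act_one by (metis image_eqI)
  have S: "act g x \<in> S" if "g \<in> SL3" "x \<in> S" for g x
    using that SL3_comp[OF that(1)] unfolding S_def by fastforce
  have zS: "act g x \<in> (*s) z ` S" if "g \<in> SL3" "x \<in> (*s) z ` S" for g x
    using that S[OF that(1)] act_scale[of g z] by fastforce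
  have disj: "S \<inter> (*s) z ` S = {}"
  proof (rule ccontr)
    assume "S \<inter> (*s) z ` S \<noteq> {}"
    then obtain x g where x: "x \<in> S" "g \<in> SL3" "x = z *s act g w" unfolding S_def by blast
    obtain h where h: "h \<in> SL3" "\<And>w. act h (act g w) = w" using SL3_inverse[OF x(2)] by metis
    have "act h x = z *s w" by (simp add: x(3) act_scale h(2))
    with S[OF h(1) x(1)] have "z *s w \<in> S" by simp
    then show False using contra assms(2) by (auto simp: orbit_scalars_def S_def)
  qed
  have closed: "zariski_closed S" using assms(1) by (simp add: polystable_def S_def)
  then obtain p where p: "polynomial_fun p" "\<And>x. x \<in> S \<Longrightarrow> p x = 0" "\<And>x. x \<in> (*s) z ` S \<Longrightarrow> p x = 1"
    using separate_disjoint_zariski_closed[OF closed zariski_closed_scale[OF closed assms(2)] disj]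
    by metis
  have adj: "conj_transpose A \<in> kron ` SL3" if A: "A \<in> kron ` SL3" for A :: "complex ^ ('m \<times> 'm \<times> 'm) ^ ('m \<times> 'm \<times> 'm)"
  proof -
    obtain g where "g \<in> SL3" "A = kron g" using A by blast
    moreover obtain g1 g2 g3 where "g = (g1, g2, g3)" by (cases g)
    ultimately show ?thesis
      by (intro image_eqI[of _ _ "(conj_transpose g1, conj_transpose g2, conj_transpose g3)"])
        (auto simp: SL3_def conj_transpose_kron det_conj_transpose)
  qed
  have stable: "A *v x \<in> S \<union> (*s) z ` S" if A: "A \<in> kron ` SL3" and x: "x \<in> S \<union> (*s) z ` S" for A x
  proof -
    obtain g where "g \<in> SL3" "A *v x = act g x" using A unfolding act_eq_kron by blast
    then show ?thesis using S[of g x] zS[of g x] x by (metis Un_iff)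
  qed
  have inv: "p (A *v x) = p x" if A: "A \<in> kron ` SL3" and x: "x \<in> S \<union> (*s) z ` S" for A x
  proof -
    obtain g where "g \<in> SL3" "A *v x = act g x" using A unfolding act_eq_kron by blast
    then show ?thesis using S[of g x] zS[of g x] p(2,3)[of x] p(2,3)[of "act g x"] x by (metis Un_iff)
  qed
  obtain f D where f: "\<And>d. polynomial_fun (f d)" "\<And>d t x. f d (t *s x) = t ^ d * f d x"
    "\<And>d A x. A \<in> kron ` SL3 \<Longrightarrow> d \<le> D \<Longrightarrow> f d (A *v x) = f d x"
    "\<And>x. x \<in> S \<union> (*s) z ` S \<Longrightarrow> p x = (\<Sum>d\<le>D. f d x)"
    by (rule invariant_polynomial_extension[OF p(1) adj stable inv]) (assumption | rule that)+
  have "f d (z *s w) = f d w" if "d \<le> D" for d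
  proof (cases "f d w = 0")
    case False
    have "restrict (f d) (orbit_closure w) \<in> invariants w d"
      unfolding invariants_def regular_functions_def
    proof (intro CollectI conjI ballI allI)
      show "\<exists>p. restrict (f d) (orbit_closure w) = restrict p (orbit_closure w) \<and> polynomial_fun p"
        using f(1) by blast
    next
      fix g :: "'m matrix3" and x assume "g \<in> SL3" "x \<in> orbit_closure w"
      moreover from this have "act g x \<in> orbit_closure w"
        using act_orbit_closure SL3_subset_GL3 by blast
      ultimately show "restrict (f d) (orbit_closure w) (act g x) = restrict (f d) (orbit_closure w) x"
        using f(3)[of "kron g" d x] that by (simp add: act_eq_kron)
    qed (simp add: f(2) scale_orbit_closure)
    moreover have "restrict (f d) (orbit_closure w) w \<noteq> 0"
      using False self_in_orbit_closure[of w] by simp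
    ultimately have "d \<in> degree_monoid w"
      unfolding degree_monoid_def using self_in_orbit_closure by (intro CollectI bexI)
    then show ?thesis using kill f(2) by simp
  qed (simp add: f(2))
  moreover have zwS: "z *s w \<in> (*s) z ` S" using wS by (rule imageI)
  ultimately have "p (z *s w) = p w" using f(4)[of "z *s w"] f(4)[of w] wS by simp
  then show False using p(2)[OF wS] p(3)[OF zwS] by simp
qed

lemma power_int_group_closure:
  fixes z :: complex
  assumes "z \<noteq> 0" "\<And>d. d \<in> E \<Longrightarrow> z ^ d = 1" "k \<in> group_closure (int ` E)"
  shows "z powi k = 1"
  using assms(3) by induction (auto simp: assms power_int_diff)

theorem theorem5p3:
  fixes w :: "('m::finite) tensor"
  assumes "w \<noteq> 0" and "polystable w"
  shows "group_closure (int ` degree_monoid w) =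
         range (\<lambda>k::int. int CARD('m) * int (stabilizer_period w) * k)"
proof -
  define n where "n = Gcd (degree_monoid w)"
  have n: "int n = Gcd (int ` degree_monoid w)" by (simp add: n_def)
  \<comment> \<open>The integers \<open>k\<close> with \<open>z powi k = 1\<close> form a group, so the equations \<open>z ^ d = 1\<close> for all degrees
    reduce to the one for the generator of the group that the degrees generate.\<close>
  have "orbit_scalars w = {z. z \<noteq> 0 \<and> z ^ n = 1}"
  proof (intro set_eqI iffI CollectI)
    fix z assume z: "z \<in> orbit_scalars w"
    then have "z \<noteq> 0" by (simp add: orbit_scalars_def)
    moreover have "z powi int n = 1"
      unfolding n using z \<open>z \<noteq> 0\<close>
      by (intro power_int_group_closure[OF _ _ Gcd_in_group_closure] degree_kills_orbit_scalars)
    ultimately show "z \<noteq> 0 \<and> z ^ n = 1" by simp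
  next
    fix z :: complex assume "z \<in> {z. z \<noteq> 0 \<and> z ^ n = 1}"
    then have z: "z \<noteq> 0" "z ^ n = 1" by auto
    have "z ^ d = 1" if "d \<in> degree_monoid w" for d
    proof -
      have "n dvd d" unfolding n_def using that by (rule Gcd_dvd)
      then show ?thesis using z(2) by (auto simp: dvd_def power_mult)
    qed
    then show "z \<in> orbit_scalars w" using orbit_scalar_if_degrees_kill[OF assms(2) z(1)] by blast
  qed
  \<comment> \<open>For \<open>n = 0\<close> the set is infinite and has cardinality \<open>0\<close> by convention.\<close>
  moreover have "card {z::complex. z \<noteq> 0 \<and> z ^ n = 1} = n"
  proof (cases "n = 0")
    case True
    have "infinite (UNIV - {0::complex})" using infinite_UNIV_char_0 by (intro Diff_infinite_finite) auto
    moreover have "UNIV - {0} = {z::complex. z \<noteq> 0 \<and> z ^ n = 1}" using True by auto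
    ultimately show ?thesis using True by simp
  next
    case False
    then have "{z::complex. z \<noteq> 0 \<and> z ^ n = 1} = {z. z ^ n = 1}" by (auto simp: power_0_left)
    then show ?thesis using False card_roots_unity_eq[of n] by simp
  qed
  ultimately have "n = CARD('m) * stabilizer_period w" using card_orbit_scalars[of w] by simp
  then have "Gcd (int ` degree_monoid w) = int CARD('m) * int (stabilizer_period w)"
    by (simp only: n[symmetric] of_nat_mult)
  then show ?thesis by (simp only: group_closure_eq)
qed

end
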